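(* Let $(B,S)$ be an equilibrium for a finite family of rollups, and let $i\in S$ be a rollup that posts blobs and $j\notin S$ a rollup that posts on the main market in it. Suppose rollups $i$ and $j$ join in posting blobs, and let $B^N$ be the blob price in an equilibrium after joining in which no rollup that posted blobs before stops posting blobs. Then $$2B\ \ge\ B^N\ \ge\ B.$$
   Context: Fixed parameters: $a,G,P_1>0$ and a target $k>0$ of blobs per time unit; metadata costs are zero ($P_0=0$). A rollup with transaction arrival rate $R>0$ posting a blob every $t$ time units at blob price $B$ has cost per transaction $\frac{B}{Rt}+\frac{at}{2}$, minimized at $t=\sqrt{2B/(aR)}$ with minimum $\sqrt{2Ba/R}$. Posting directly on the L1 main market instead has optimal cost per transaction $P_1G$. Each rollup uses the strategy with lower optimal cost per transaction (either one in case of a tie). An equilibrium for a finite family of rollups with rates $(R_l)_{l\in I}$, $R_l>0$, is a pair $(B,S)$ where $B>0$ is the blob price and $\emptyset\ne S\subseteq I$ is the set of blob-posting rollups, such that: (i) the blob target is met, $\sum_{l\in S}\sqrt{aR_l/(2B)}=k$, equivalently $B=\frac{a}{2k^2}\bigl(\sum_{l\in S}\sqrt{R_l}\bigr)^2$; (ii) $\sqrt{2Ba/R_l}\le P_1G$ for $l\in S$; (iii) $\sqrt{2Ba/R_l}\ge P_1G$ for $l\in I\setminus S$. When rollups $i$ and $j$ join in posting blobs, they are replaced in the family by a single joint rollup with arrival rate $R_i+R_j$. An equilibrium after joining is an equilibrium $(B^N,S^N)$ for the new family in which the joint rollup belongs to $S^N$ (it posts blobs). That no rollup stops posting blobs means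 $S\setminus\{i,j\}\subseteq S^N$. *)

theory Defs
  imports Complex_Main
begin

definition blob_cost :: "real \<Rightarrow> real \<Rightarrow> real \<Rightarrow> real \<Rightarrow> real" where
  "blob_cost a r B t = B / (r * t) + a * t / 2"

definition opt_interval :: "real \<Rightarrow> real \<Rightarrow> real \<Rightarrow> real" where
  "opt_interval a r B = sqrt (2 * B / (a * r))"

definition opt_blob_cost :: "real \<Rightarrow> real \<Rightarrow> real \<Rightarrow> real" where
  "opt_blob_cost a r B = sqrt (2 * B * a / r)"

lemma opt_interval_pos:
  assumes "a > 0" "r > 0" "B > 0"
  shows "opt_interval a r B > 0"
  using assms by (simp add: opt_interval_def)

lemma blob_cost_opt_interval:
  assumes "a > 0" "r > 0" "B > 0"
  shows "blob_cost a r B (opt_interval a r B) = opt_blob_cost a r B"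
proof -
  define t where "t = opt_interval a r B"
  have t: "t > 0" using opt_interval_pos[OF assms] by (simp add: t_def)
  have t2: "t * t = 2 * B / (a * r)"
    using assms by (simp add: t_def opt_interval_def)
  have "B = a * r * (t * t) / 2" using assms by (simp add: t2)
  then have "blob_cost a r B t = a * t"
    using t assms by (simp add: blob_cost_def field_simps)
  moreover have "opt_blob_cost a r B = a * t"
  proof -
    have "2 * B * a / r = (a * t)\<^sup>2"
      using assms by (simp add: power2_eq_square algebra_simps t2)
    then show ?thesis using t assms by (simp add: opt_blob_cost_def)
  qed
  ultimately show ?thesis by (simp add: t_def)
qed

lemma opt_blob_cost_le:
  assumes "a > 0" "r > 0" "B > 0" "t > 0"
  shows "opt_blob_cost a r B \<le> blob_cost a r B t"
proof -
  have "(B / (r * t) + a * t / 2)\<^sup>2 - 2 * B * a / r = (B / (r * t) - a * t / 2)\<^sup>2"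
    using assms by (simp add: power2_eq_square field_simps)
  then have "2 * B * a / r \<le> (B / (r * t) + a * t / 2)\<^sup>2"
    by (smt (verit) zero_le_power2)
  then show ?thesis
    unfolding opt_blob_cost_def blob_cost_def
    using assms by (intro real_le_lsqrt) auto
qed

text \<open>
  The summand \<open>sqrt (a * R l / (2 * B))\<close> is the number of blobs per time unit of rollup \<open>l\<close>, i.e.
  \<open>1 / opt_interval a (R l) B\<close>. In a tie between the two costs either strategy is allowed,
  hence the weak inequalities. Finiteness of \<open>I\<close> and positivity of \<open>R\<close> on \<open>I\<close> and of the
  parameters are not part of this predicate.
\<close>

definition equilibrium ::
  "real \<Rightarrow> real \<Rightarrow> real \<Rightarrow> real \<Rightarrow> 'l set \<Rightarrow> ('l \<Rightarrow> real) \<Rightarrow> real \<Rightarrow> 'l set \<Rightarrow> bool" where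
  "equilibrium a G P1 k I R B S \<longleftrightarrow>
     B > 0 \<and> S \<noteq> {} \<and> S \<subseteq> I \<and>
     (\<Sum>l\<in>S. sqrt (a * R l / (2 * B))) = k \<and>
     (\<forall>l\<in>S. opt_blob_cost a (R l) B \<le> P1 * G) \<and>
     (\<forall>l\<in>I - S. opt_blob_cost a (R l) B \<ge> P1 * G)"

lemma blob_rate_eq_inverse_opt_interval:
  "sqrt (a * r / (2 * B)) = 1 / opt_interval a r B"
  by (simp add: opt_interval_def real_sqrt_divide)

lemma blob_target_iff_price:
  assumes "a > 0" "k > 0" "B > 0" "\<And>l. l \<in> S \<Longrightarrow> R l > 0"
  shows "(\<Sum>l\<in>S. sqrt (a * R l / (2 * B))) = k \<longleftrightarrow>
         B = a / (2 * k\<^sup>2) * (\<Sum>l\<in>S. sqrt (R l))\<^sup>2"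
proof -
  let ?s = "\<Sum>l\<in>S. sqrt (R l)"
  have s: "?s \<ge> 0" using assms(4) by (intro sum_nonneg) (auto simp: less_imp_le)
  have eq: "(\<Sum>l\<in>S. sqrt (a * R l / (2 * B))) = sqrt (a / (2 * B)) * ?s"
    by (simp add: sum_distrib_left real_sqrt_mult real_sqrt_divide)
  have "sqrt (a / (2 * B)) * ?s = k \<longleftrightarrow> (sqrt (a / (2 * B)) * ?s)\<^sup>2 = k\<^sup>2"
    using s assms by (intro power2_eq_iff_nonneg[symmetric]) auto
  also have "\<dots> \<longleftrightarrow> a / (2 * B) * ?s\<^sup>2 = k\<^sup>2"
    using assms by (simp add: power_mult_distrib)
  also have "\<dots> \<longleftrightarrow> B = a / (2 * k\<^sup>2) * ?s\<^sup>2"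
    using assms by (auto simp: field_simps)
  finally show ?thesis by (simp only: eq)
qed

text \<open>
  In the family after rollups \<open>i\<close> and \<open>j\<close> have joined, \<open>None\<close> is the joint rollup and
  \<open>Some l\<close> is the unchanged rollup \<open>l\<close>.
\<close>

definition joined_family :: "'l set \<Rightarrow> 'l \<Rightarrow> 'l \<Rightarrow> 'l option set" where
  "joined_family I i j = insert None (Some ` (I - {i, j}))"

definition joined_rate :: "('l \<Rightarrow> real) \<Rightarrow> 'l \<Rightarrow> 'l \<Rightarrow> 'l option \<Rightarrow> real" where
  "joined_rate R i j x = (case x of None \<Rightarrow> R i + R j | Some l \<Rightarrow> R l)"

definition equilibrium_after_joining ::
  "real \<Rightarrow> real \<Rightarrow> real \<Rightarrow> real \<Rightarrow> 'l set \<Rightarrow> ('l \<Rightarrow> real) \<Rightarrow> 'l \<Rightarrow> 'l \<Rightarrow> real \<Rightarrow> 'l option set \<Rightarrow> bool"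
where
  "equilibrium_after_joining a G P1 k I R i j B S \<longleftrightarrow>
     equilibrium a G P1 k (joined_family I i j) (joined_rate R i j) B S \<and> None \<in> S"

end

theory Submission
  imports Defs
begin

text \<open>
  The price is proportional to the squared sum of \<open>sqrt (R l)\<close> over the posting rollups. Joining
  does not decrease this sum, hence \<open>B \<le> BN\<close>. If some rollup starts posting, it does so only
  because the price has not risen, so \<open>BN \<le> B\<close>. Otherwise only the summand of \<open>i\<close> changes, and
  since \<open>i\<close> posts and \<open>j\<close> does not, \<open>R j \<le> R i\<close>; so the sum grows by a factor of at most \<open>sqrt 2\<close>.
\<close>

text \<open>Each cost is the square root of \<open>2 * a\<close> times the ratio of price to rate,
  and \<open>sqrt\<close> is strictly monotone. Both price and rate vary, so that the lemma can
  compare two prices at one rate and two rates at one price.\<close>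

lemma opt_blob_cost_le_iff:
  assumes "a > 0"
  shows "opt_blob_cost a r B \<le> opt_blob_cost a r' B' \<longleftrightarrow> B / r \<le> B' / r'"
proof -
  have "2 * a > 0" "2 * B * a / r = 2 * a * (B / r)" "2 * B' * a / r' = 2 * a * (B' / r')"
    using assms by simp_all
  then show ?thesis
    using assms by (simp only: opt_blob_cost_def real_sqrt_le_iff mult_le_cancel_left_pos)
qed

lemma equilibrium_price:
  assumes "equilibrium a G P1 k I R B S" "a > 0" "k > 0" "\<And>l. l \<in> I \<Longrightarrow> R l > 0"
  shows "B = a / (2 * k\<^sup>2) * (\<Sum>l\<in>S. sqrt (R l))\<^sup>2"
proof -
  have "B > 0" "S \<subseteq> I" "(\<Sum>l\<in>S. sqrt (a * R l / (2 * B))) = k"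
    using assms(1) by (auto simp: equilibrium_def)
  then show ?thesis
    using blob_target_iff_price[of a k B S R] assms by blast
qed

text \<open>Splitting off \<open>None\<close> leaves a sum over original rollups with their old
  rates, which can be compared with the sum over the old posting set.\<close>

lemma joined_posting_sum:
  assumes "finite I" "None \<in> SN" "SN \<subseteq> joined_family I i j"
  shows "(\<Sum>x\<in>SN. sqrt (joined_rate R i j x))
    = sqrt (R i + R j) + (\<Sum>l\<in>Some -` SN. sqrt (R l))"
proof -
  define A where "A = Some -` SN"
  have SN: "SN = insert None (Some ` A)"
  proof (intro set_eqI iffI)
    fix x assume "x \<in> SN"
    then show "x \<in> insert None (Some ` A)" by (cases x) (auto simp: A_def)
  qed (use assms(2) in \<open>auto simp: A_def\<close>)
  have "finite A"
    using assms by (auto intro: finite_subset[of _ I] simp: A_def joined_family_def)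
  then have "(\<Sum>x\<in>insert None (Some ` A). sqrt (joined_rate R i j x))
    = sqrt (R i + R j) + (\<Sum>l\<in>A. sqrt (R l))"
    by (subst sum.insert) (auto simp: joined_rate_def sum.reindex)
  then show ?thesis
    by (simp flip: SN A_def)
qed

theorem proposition3:
  fixes a G P1 k B BN :: real
    and I S :: "'l set" and R :: "'l \<Rightarrow> real" and i j :: 'l and SN :: "'l option set"
  assumes "a > 0" and "G > 0" and "P1 > 0" and "k > 0"
    and "finite I" and "\<And>l. l \<in> I \<Longrightarrow> R l > 0"
    and "equilibrium a G P1 k I R B S"
    and "i \<in> S" and "j \<in> I" and "j \<notin> S"
    and "equilibrium_after_joining a G P1 k I R i j BN SN"
    and "Some ` (S - {i, j}) \<subseteq> SN"
  shows "2 * B \<ge> BN \<and> BN \<ge> B"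
proof -
  let ?T = "\<lambda>A. \<Sum>l\<in>A. sqrt (R l)"
  \<comment> \<open>The unmerged rollups that post after joining, as a set of the same type as
    \<open>S\<close>.\<close>
  define A where "A = Some -` SN"
  have eqN: "equilibrium a G P1 k (joined_family I i j) (joined_rate R i j) BN SN"
    and None: "None \<in> SN"
    using assms(11) by (auto simp: equilibrium_after_joining_def)
  have SI: "S \<subseteq> I" and B: "B > 0"
    using assms(7) by (auto simp: equilibrium_def)
  then have R: "R i > 0" "R j > 0" "i \<in> I"
    using assms(6,8,9) by auto
  have SNsub: "SN \<subseteq> joined_family I i j"
    using eqN by (auto simp: equilibrium_def)
  have AI: "A \<subseteq> I - {i, j}"
    using SNsub by (auto simp: A_def joined_family_def)
  \<comment> \<open>As \<open>j \<notin> S\<close>, the set \<open>S - {i, j}\<close> is just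
    \<open>S - {i}\<close>.\<close>
  have SA: "S - {i} \<subseteq> A"
    using assms(10,12) by (auto simp: A_def)
  have finS: "finite S" and finA: "finite A"
    using SI AI assms(5) by (auto intro: finite_subset)
  have rate_pos: "joined_rate R i j x > 0" if "x \<in> joined_family I i j" for x
    using that add_pos_pos[OF R(1,2)] assms(6)
    by (auto simp: joined_rate_def joined_family_def)
  have priceB: "B = a / (2 * k\<^sup>2) * (?T S)\<^sup>2"
    using equilibrium_price[OF assms(7,1,4,6)] .
  have priceN: "BN = a / (2 * k\<^sup>2) * (sqrt (R i + R j) + ?T A)\<^sup>2"
    using equilibrium_price[OF eqN assms(1,4) rate_pos]
      joined_posting_sum[OF assms(5) None SNsub] by (simp add: A_def)
  have c: "a / (2 * k\<^sup>2) \<ge> 0"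
    using assms(1) by simp
  have TS: "?T S = sqrt (R i) + ?T (S - {i})"
    using finS assms(8) by (rule sum.remove)
  have rest_nonneg: "?T (S - {i}) \<ge> 0"
    using SI assms(6) by (intro sum_nonneg) (auto simp: less_imp_le subset_eq)
  have "?T (S - {i}) \<le> ?T A"
    using finA SA AI assms(6) by (intro sum_mono2) (auto simp: less_imp_le subset_eq)
  moreover have "sqrt (R i) \<le> sqrt (R i + R j)"
    using R by simp
  ultimately have "?T S \<le> sqrt (R i + R j) + ?T A"
    using TS by linarith
  moreover have "0 \<le> ?T S"
    using TS R rest_nonneg by simp
  ultimately have lower: "B \<le> BN"
    unfolding priceB priceN using c by (intro mult_left_mono power_mono)
  have out: "P1 * G \<le> opt_blob_cost a (R l) B" if "l \<in> I - S" for l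
    using that assms(7) by (auto simp: equilibrium_def)
  have "BN \<le> 2 * B"
  proof (cases "A \<subseteq> S")
    case False
    then obtain l where l: "l \<in> A" "l \<notin> S" "l \<in> I"
      using AI by auto
    \<comment> \<open>The newcomer \<open>l\<close> keeps its rate, and its posting cost is at most
      \<open>P1 * G\<close> at price \<open>BN\<close> but at least \<open>P1 * G\<close> at price
      \<open>B\<close>.\<close>
    have "opt_blob_cost a (R l) BN \<le> P1 * G"
      using l(1) eqN unfolding A_def equilibrium_def
      by (force simp: joined_rate_def)
    also have "\<dots> \<le> opt_blob_cost a (R l) B"
      using l by (intro out) auto
    finally have "BN / R l \<le> B / R l"
      using opt_blob_cost_le_iff[OF assms(1)] by blast
    then have "BN \<le> B"
      using assms(6)[OF l(3)] by (simp add: divide_le_cancel)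
    then show ?thesis
      using B by linarith
  next
    case True
    then have A: "A = S - {i}"
      using AI SA by auto
    \<comment> \<open>In the old equilibrium the threshold \<open>P1 * G\<close> separates the
      posting costs of \<open>i\<close> and \<open>j\<close>, which orders their rates.\<close>
    have "opt_blob_cost a (R i) B \<le> P1 * G"
      using assms(7,8) by (auto simp: equilibrium_def)
    also have "\<dots> \<le> opt_blob_cost a (R j) B"
      using assms(9,10) by (intro out) auto
    finally have "B / R i \<le> B / R j"
      using opt_blob_cost_le_iff[OF assms(1)] by blast
    then have "R j \<le> R i"
      using B R by (simp add: field_simps)
    then have "sqrt (R i + R j) \<le> sqrt 2 * sqrt (R i)"
      by (simp flip: real_sqrt_mult)
    \<comment> \<open>The unchanged summands are enlarged by \<open>sqrt 2\<close> as well, so that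
      this factor comes out of the whole sum; squaring turns it into 2.\<close>
    moreover have "?T (S - {i}) \<le> sqrt 2 * ?T (S - {i})"
      using mult_right_mono[of 1 "sqrt 2", OF _ rest_nonneg] by simp
    ultimately have "sqrt (R i + R j) + ?T A \<le> sqrt 2 * ?T S"
      unfolding A TS by (simp add: distrib_left)
    moreover have "0 \<le> sqrt (R i + R j) + ?T A"
      using R rest_nonneg by (simp add: A)
    ultimately have "BN \<le> a / (2 * k\<^sup>2) * (sqrt 2 * ?T S)\<^sup>2"
      unfolding priceN using c by (intro mult_left_mono power_mono)
    also have "\<dots> = 2 * B"
      unfolding priceB by (simp add: power_mult_distrib)
    finally show ?thesis .
  qed
  with lower show ?thesis
    by simp
qed

end
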